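(* Let $g>0$, $h_\ell,h_r>0$ and $u_\ell,u_r\in\mathbb{R}$ satisfy $u_r-u_\ell<2\sqrt{gh_\ell}+2\sqrt{gh_r}$, let $\phi$ be the associated depth function for the shallow water Riemann problem, let $h_*>0$ be its unique root in $(0,\infty)$, and let $h_{\min}=\min(h_\ell,h_r)$. For any $h^{[0]}>0$, $$h^{[0]}-\frac{\phi(h^{[0]})}{\phi'(h^{[0]})}\le h_*.$$ Moreover, suppose $h_{\min}\le h_*$ and set $$\tilde h^{[0]}:=\max\left(h_{\min},\;h^{[0]}-\frac{\phi(h^{[0]})}{\phi'(h^{[0]})}\right).$$ Then $\tilde h^{[0]}\le h_*$, and Newton's method for $\phi$ started from $\tilde h^{[0]}$ (that is, $\tilde h^{[k+1]}=\tilde h^{[k]}-\phi(\tilde h^{[k]})/\phi'(\tilde h^{[k]})$ for $k\ge0$) has all iterates positive and converges to $h_*$.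
   Context: For $h>0$ the depth function is $\phi(h)=f(h;h_\ell)+f(h;h_r)+u_r-u_\ell$, where, for $s\in\{\ell,r\}$, $$f(h;h_s)=\begin{cases}2\left(\sqrt{gh}-\sqrt{gh_s}\right) & \text{if } h\le h_s,\\[4pt] (h-h_s)\sqrt{\tfrac12 g\,\dfrac{h+h_s}{h\,h_s}} & \text{if } h>h_s.\end{cases}$$ The condition $u_r-u_\ell<2\sqrt{gh_\ell}+2\sqrt{gh_r}$ says that no dry state occurs; under it $\phi$ has exactly one root $h_*$ in $(0,\infty)$, the depth of the intermediate state in the Riemann solution. Here $g$ is the gravitational constant. The iteration described in the claim is called the positive Newton method. *)

theory Defs
  imports "HOL-Analysis.Analysis"
begin

definition wave_fun :: "real \<Rightarrow> real \<Rightarrow> real \<Rightarrow> real" where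
  "wave_fun g hs h =
     (if h \<le> hs then 2 * (sqrt (g * h) - sqrt (g * hs))
      else (h - hs) * sqrt (1 / 2 * g * ((h + hs) / (h * hs))))"

definition depth_fun :: "real \<Rightarrow> real \<Rightarrow> real \<Rightarrow> real \<Rightarrow> real \<Rightarrow> real \<Rightarrow> real" where
  "depth_fun g hl hr ul ur h = wave_fun g hl h + wave_fun g hr h + ur - ul"

(* Only meaningful when there is exactly one positive root; this follows from
   g, hl, hr > 0 and the no-dry-state condition. *)
definition intermediate_depth :: "real \<Rightarrow> real \<Rightarrow> real \<Rightarrow> real \<Rightarrow> real \<Rightarrow> real" where
  "intermediate_depth g hl hr ul ur = (THE h. 0 < h \<and> depth_fun g hl hr ul ur h = 0)"

definition newton_step :: "(real \<Rightarrow> real) \<Rightarrow> real \<Rightarrow> real" where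
  "newton_step F x = x - F x / deriv F x"

primrec newton_iter :: "(real \<Rightarrow> real) \<Rightarrow> real \<Rightarrow> nat \<Rightarrow> real" where
  "newton_iter F x0 0 = x0"
| "newton_iter F x0 (Suc k) = newton_step F (newton_iter F x0 k)"

end

(* Each wave function is C^1, strictly increasing and concave on (0, \<infinity>), hence so is the depth
   function.  By concavity the graph lies below each tangent line, so one Newton step from any point
   lands to the left of the root; to the left of the root the function is negative, so there the
   steps go to the right, and the iterates increase to the root. *)
theory Submission
  imports Defs
begin

section \<open>Newton's method for an increasing concave function\<close>

text \<open>By the mean value theorem the secant slope between \<open>x\<close> and \<open>y\<close>
  is some \<open>F' z\<close> with \<open>z\<close> in between. To the right of \<open>x\<close>
  this slope is at most \<open>F' x\<close>, to the left at least \<open>F' x\<close>; the sign of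
  \<open>y - x\<close> turns both cases into the same bound.\<close>

lemma DERIV_antimono_imp_below_tangent:
  fixes F F' :: "real \<Rightarrow> real"
  assumes der: "\<And>x. x > 0 \<Longrightarrow> (F has_real_derivative F' x) (at x)"
    and anti: "\<And>x y. 0 < x \<Longrightarrow> x \<le> y \<Longrightarrow> F' y \<le> F' x"
    and "x > 0" and "y > 0"
  shows "F y \<le> F x + F' x * (y - x)"
proof -
  consider "x < y" | "y < x" | "x = y" by linarith
  then show ?thesis
  proof cases
    case 1
    then obtain z where z: "z > x" "z < y" "F y - F x = (y - x) * F' z"
      using MVT2[of x y F F'] der \<open>x > 0\<close> by auto
    have "(y - x) * F' z \<le> (y - x) * F' x"
      using anti[of x z] z 1 \<open>x > 0\<close> by (intro mult_left_mono) auto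
    with z show ?thesis by (simp add: algebra_simps)
  next
    case 2
    then obtain z where z: "z > y" "z < x" "F x - F y = (x - y) * F' z"
      using MVT2[of y x F F'] der \<open>y > 0\<close> by auto
    have "(x - y) * F' x \<le> (x - y) * F' z"
      using anti[of z x] z 2 \<open>y > 0\<close> by (intro mult_left_mono) auto
    with z show ?thesis by (simp add: algebra_simps)
  qed simp
qed

text \<open>The tangent at \<open>x\<close> has a nonnegative value at \<open>r\<close>, because it
  lies above \<open>F r = 0\<close>; as its slope is positive, its own zero, the Newton step, comes
  no later than \<open>r\<close>.\<close>

lemma newton_step_le_root:
  fixes F F' :: "real \<Rightarrow> real"
  assumes der: "\<And>x. x > 0 \<Longrightarrow> (F has_real_derivative F' x) (at x)"
    and anti: "\<And>x y. 0 < x \<Longrightarrow> x \<le> y \<Longrightarrow> F' y \<le> F' x"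
    and pos: "\<And>x. x > 0 \<Longrightarrow> F' x > 0"
    and "r > 0" and "F r = 0" and "x > 0"
  shows "newton_step F x \<le> r"
proof -
  have "0 \<le> F x + F' x * (r - x)"
    using DERIV_antimono_imp_below_tangent[OF der anti \<open>x > 0\<close> \<open>r > 0\<close>] \<open>F r = 0\<close> by simp
  then show ?thesis
    using pos[OF \<open>x > 0\<close>] DERIV_imp_deriv[OF der[OF \<open>x > 0\<close>]]
    by (simp add: newton_step_def field_simps)
qed

text \<open>The iterates stay in the interval from \<open>x0\<close> to \<open>r\<close>, hence in
  the positive domain, and increase, so they have a limit \<open>L\<close>. The residuals tend to 0,
  which makes \<open>L\<close> a root, and strict monotonicity of \<open>F\<close> leaves only
  \<open>r\<close>.\<close>

lemma newton_iter_increasing_concave: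
  fixes F F' :: "real \<Rightarrow> real"
  assumes der: "\<And>x. x > 0 \<Longrightarrow> (F has_real_derivative F' x) (at x)"
    and anti: "\<And>x y. 0 < x \<Longrightarrow> x \<le> y \<Longrightarrow> F' y \<le> F' x"
    and pos: "\<And>x. x > 0 \<Longrightarrow> F' x > 0"
    and r: "r > 0" "F r = 0" and x0: "0 < x0" "x0 \<le> r"
  shows "newton_iter F x0 k > 0" and "newton_iter F x0 \<longlonglongrightarrow> r"
proof -
  let ?X = "newton_iter F x0"
  have mono: "F x < F y" if "0 < x" "x < y" for x y
    using that der pos by (meson DERIV_pos_imp_increasing less_le_trans)
  have step_ge: "newton_step F x \<ge> x" if "0 < x" "x \<le> r" for x
  proof -
    have "F x \<le> 0" using mono[of x r] that r by (cases "x = r") auto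
    then show ?thesis
      using pos[OF \<open>0 < x\<close>] DERIV_imp_deriv[OF der[OF \<open>0 < x\<close>]]
      by (simp add: newton_step_def divide_nonpos_pos)
  qed
  have bounds: "x0 \<le> ?X n \<and> ?X n \<le> r" for n
  proof (induction n)
    case (Suc n)
    then have "0 < ?X n" using x0 by linarith
    then show ?case
      using Suc step_ge[of "?X n"] newton_step_le_root[OF der anti pos r] by fastforce
  qed (use x0 in simp)
  then have X_pos: "?X n > 0" for n using x0 by (meson less_le_trans)
  then show "?X k > 0" .
  have "incseq ?X"
    using bounds X_pos step_ge by (intro incseq_SucI) simp
  then obtain L where L: "?X \<longlonglongrightarrow> L"
    using bounds incseq_convergent[of ?X r] by metis
  have "x0 \<le> L" using L bounds by (intro LIMSEQ_le_const) auto
  then have "L > 0" using x0 by linarith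
  \<comment> \<open>The Newton step solved for the residual: \<open>F\<close> at an iterate is slope
    times step length. All iterates lie to the right of \<open>x0\<close>, so the slope is at most
    \<open>F' x0\<close>, and step lengths of a convergent sequence vanish.\<close>
  have upper: "\<bar>F (?X n)\<bar> \<le> F' x0 * \<bar>?X n - ?X (Suc n)\<bar>" for n
  proof -
    have "F (?X n) = F' (?X n) * (?X n - ?X (Suc n))"
      using pos[OF X_pos[of n]] DERIV_imp_deriv[OF der[OF X_pos[of n]]]
      by (simp add: newton_step_def)
    moreover have "\<bar>F' (?X n)\<bar> \<le> F' x0"
      using anti[of x0 "?X n"] bounds[of n] x0 pos[OF X_pos[of n]] by simp
    ultimately show ?thesis by (metis abs_ge_zero abs_mult mult_right_mono)
  qed
  have "(\<lambda>n. F' x0 * \<bar>?X n - ?X (Suc n)\<bar>) \<longlonglongrightarrow> F' x0 * \<bar>L - L\<bar>"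
    by (intro tendsto_intros L LIMSEQ_Suc[OF L])
  then have lim: "(\<lambda>n. F' x0 * \<bar>?X n - ?X (Suc n)\<bar>) \<longlonglongrightarrow> 0" by simp
  have "(\<lambda>n. F (?X n)) \<longlonglongrightarrow> 0"
    by (rule Lim_null_comparison[OF always_eventually lim]) (simp only: real_norm_def upper simp_thms)
  moreover have "(\<lambda>n. F (?X n)) \<longlonglongrightarrow> F L"
    using DERIV_isCont[OF der[OF \<open>L > 0\<close>]] L by (rule isCont_tendsto_compose)
  ultimately have "F L = 0" using LIMSEQ_unique by blast
  then have "L = r"
    using mono[of L r] mono[of r L] \<open>L > 0\<close> r by (cases L r rule: linorder_cases) auto
  with L show "?X \<longlonglongrightarrow> r" by simp
qed

section \<open>The wave functions and the depth function\<close>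

(* For h > hs the derivative is
   sqrt (g * (2 h^2 + h hs + hs^2)^2 / (8 hs h^3 (h + hs))); expanding the numerator in powers
   of hs makes the monotonicity in h evident. *)
definition shock_deriv :: "real \<Rightarrow> real \<Rightarrow> real \<Rightarrow> real" where
  "shock_deriv g hs h =
     sqrt (g / (8 * hs) * (4 + 5 * hs^2 / (h * (h + hs)) + 2 * hs^3 / (h^2 * (h + hs))
       + hs^4 / (h^3 * (h + hs))))"

definition wave_deriv :: "real \<Rightarrow> real \<Rightarrow> real \<Rightarrow> real" where
  "wave_deriv g hs h = (if h \<le> hs then sqrt (g / h) else shock_deriv g hs h)"

text \<open>The two branches meet with equal slope. This gives differentiability of the wave
  function at \<open>hs\<close> and lets the monotonicity of the derivative pass from one branch to
  the other.\<close>

lemma shock_deriv_at_hs: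
  assumes "hs > 0"
  shows "shock_deriv g hs hs = sqrt (g / hs)"
proof -
  have eqs: "5 * hs^2 / (hs * (hs + hs)) = 5 / 2" "2 * hs^3 / (hs^2 * (hs + hs)) = 1"
    "hs^4 / (hs^3 * (hs + hs)) = 1 / 2"
    using assms by (simp_all add: field_simps power2_eq_square power3_eq_cube power4_eq_xxxx)
  show ?thesis unfolding shock_deriv_def eqs by simp
qed

text \<open>The set \<open>S\<close> is arbitrary so that the one-sided derivative at
  \<open>hs\<close> is available when the branches are glued.\<close>

lemma rarefaction_has_derivative:
  assumes "g > 0" "h > 0"
  shows "((\<lambda>h. 2 * (sqrt (g * h) - sqrt (g * hs))) has_real_derivative sqrt (g / h)) (at h within S)"
proof -
  have "((\<lambda>h. sqrt (g * h)) has_real_derivative inverse (sqrt (g * h)) / 2 * g) (at h within S)"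
    using assms by (intro DERIV_chain2[where f = sqrt and g = "(*) g"] DERIV_real_sqrt DERIV_cmult_Id) simp
  from DERIV_cmult[OF DERIV_diff[OF this DERIV_const], of 2 "sqrt (g * hs)"]
  have "((\<lambda>h. 2 * (sqrt (g * h) - sqrt (g * hs))) has_real_derivative
      inverse (sqrt (g * h)) * g) (at h within S)"
    by simp
  moreover have "inverse (sqrt (g * h)) * g = sqrt (g / h)"
    using assms by (simp add: real_sqrt_mult real_sqrt_divide field_simps)
  ultimately show ?thesis by metis
qed

lemma shock_has_derivative:
  assumes "g > 0" "hs > 0" "h > 0"
  shows "((\<lambda>h. (h - hs) * sqrt (1 / 2 * g * ((h + hs) / (h * hs)))) has_real_derivative
    shock_deriv g hs h) (at h within S)"
proof -
  \<comment> \<open>\<open>W\<close> is the radicand, with derivative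
    \<open>W' = - g / (2 * h^2)\<close>. The product rule gives
    \<open>sqrt W + (h - hs) * W' / (2 * sqrt W)\<close>, which is \<open>N / sqrt W\<close> for
    \<open>N = W + (h - hs) * W' / 2\<close>.\<close>
  define W where "W = 1 / 2 * g * ((h + hs) / (h * hs))"
  define N where "N = g * (2 * h^2 + h * hs + hs^2) / (4 * hs * h^2)"
  have "W > 0" using assms by (simp add: W_def)
  have "N > 0" using assms by (auto simp: N_def intro!: divide_pos_pos mult_pos_pos add_pos_pos)
  have "((\<lambda>h. 1 / 2 * g * ((h + hs) / (h * hs))) has_real_derivative - g / (2 * h^2)) (at h within S)"
    using assms by (auto intro!: derivative_eq_intros simp: field_simps power2_eq_square)
  then have "((\<lambda>h. sqrt (1 / 2 * g * ((h + hs) / (h * hs)))) has_real_derivative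
      inverse (sqrt W) / 2 * (- g / (2 * h^2))) (at h within S)"
    using \<open>W > 0\<close> unfolding W_def
    by (intro DERIV_chain2[where f = sqrt and g = "\<lambda>h. 1 / 2 * g * ((h + hs) / (h * hs))"]
        DERIV_real_sqrt)
  moreover have "((\<lambda>h. h - hs) has_real_derivative 1) (at h within S)"
    by (auto intro!: derivative_eq_intros)
  ultimately have "((\<lambda>h. (h - hs) * sqrt (1 / 2 * g * ((h + hs) / (h * hs)))) has_real_derivative
      sqrt W + (h - hs) * (inverse (sqrt W) / 2 * (- g / (2 * h^2)))) (at h within S)"
    unfolding W_def using DERIV_mult by (fastforce simp: mult.commute)
  moreover have "sqrt W + (h - hs) * (inverse (sqrt W) / 2 * (- g / (2 * h^2))) = N / sqrt W"
  proof -
    have N: "N = W - (h - hs) * g / (4 * h^2)"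
      using assms by (simp add: N_def W_def field_simps power2_eq_square)
    have "W / sqrt W = sqrt W" using \<open>W > 0\<close> by (simp add: real_div_sqrt)
    then show ?thesis unfolding N diff_divide_distrib by (simp add: field_simps)
  qed
  \<comment> \<open>Positivity of \<open>N\<close> allows the quotient to be written as a single
    root, the form of \<open>shock_deriv\<close>.\<close>
  moreover have "N / sqrt W = sqrt (N^2 / W)"
    using \<open>N > 0\<close> by (simp add: real_sqrt_divide)
  moreover have "N^2 / W = g / (8 * hs) * (4 + 5 * hs^2 / (h * (h + hs))
      + 2 * hs^3 / (h^2 * (h + hs)) + hs^4 / (h^3 * (h + hs)))"
  proof -
    have "h + hs \<noteq> 0" using assms by simp
    then have "4 + 5 * hs^2 / (h * (h + hs)) + 2 * hs^3 / (h^2 * (h + hs)) + hs^4 / (h^3 * (h + hs))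
        = (4 * h^3 * (h + hs) + 5 * hs^2 * h^2 + 2 * hs^3 * h + hs^4) / (h^3 * (h + hs))"
      using assms by (simp add: add_divide_distrib power2_eq_square power3_eq_cube)
    also have "4 * h^3 * (h + hs) + 5 * hs^2 * h^2 + 2 * hs^3 * h + hs^4
        = (2 * h^2 + h * hs + hs^2)^2"
      by algebra
    finally show ?thesis
      using assms \<open>h + hs \<noteq> 0\<close>
      by (simp add: N_def W_def power_divide power_mult_distrib)
        (simp add: power2_eq_square power3_eq_cube power4_eq_xxxx mult_ac)
  qed
  ultimately show ?thesis by (simp add: shock_deriv_def)
qed

lemma wave_fun_has_derivative:
  assumes "g > 0" "hs > 0" "h > 0"
  shows "(wave_fun g hs has_real_derivative wave_deriv g hs h) (at h)"
proof -
  \<comment> \<open>The case distinction is phrased as membership to fit the gluing rule for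
    \<open>{..hs}\<close> and \<open>{hs<..}\<close>, whose closures share only the point
    \<open>hs\<close>.\<close>
  have "((\<lambda>h. if h \<in> {..hs} then 2 * (sqrt (g * h) - sqrt (g * hs))
      else (h - hs) * sqrt (1 / 2 * g * ((h + hs) / (h * hs)))) has_vector_derivative
    (if h \<in> {..hs} then sqrt (g / h) else shock_deriv g hs h)) (at h within UNIV)"
    using rarefaction_has_derivative[OF assms(1,3), unfolded has_real_derivative_iff_has_vector_derivative]
      shock_has_derivative[OF assms, unfolded has_real_derivative_iff_has_vector_derivative]
      shock_deriv_at_hs[OF assms(2)] assms
    by (intro has_vector_derivative_If_within_closures[where T = "{hs<..}"]) auto
  then show ?thesis
    by (simp add: has_real_derivative_iff_has_vector_derivative wave_fun_def[abs_def] wave_deriv_def)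
qed

lemma wave_deriv_pos:
  assumes "g > 0" "hs > 0" "h > 0"
  shows "wave_deriv g hs h > 0"
proof (cases "h \<le> hs")
  case False
  have "0 < 4 + 5 * hs^2 / (h * (h + hs)) + 2 * hs^3 / (h^2 * (h + hs)) + hs^4 / (h^3 * (h + hs))"
    using assms by (intro add_pos_pos divide_pos_pos mult_pos_pos) auto
  then have "0 < g / (8 * hs) * (4 + 5 * hs^2 / (h * (h + hs)) + 2 * hs^3 / (h^2 * (h + hs))
      + hs^4 / (h^3 * (h + hs)))"
    using assms by (intro mult_pos_pos divide_pos_pos) auto
  with False show ?thesis unfolding wave_deriv_def shock_deriv_def by (simp only: real_sqrt_gt_0_iff if_False)
qed (use assms in \<open>simp add: wave_deriv_def\<close>)

text \<open>Under each root \<open>h\<close> occurs only in denominators, with positive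
  coefficients, so each branch decreases. Points on different sides of \<open>hs\<close> are
  compared through the common value at \<open>hs\<close>.\<close>

lemma wave_deriv_antimono:
  assumes "g > 0" "hs > 0" "0 < x" "x \<le> y"
  shows "wave_deriv g hs y \<le> wave_deriv g hs x"
proof -
  have D_anti: "shock_deriv g hs v \<le> shock_deriv g hs u" if "0 < u" "u \<le> v" for u v
    unfolding shock_deriv_def using that assms
    by (intro real_sqrt_le_mono mult_left_mono add_mono divide_left_mono mult_mono power_mono) auto
  have R_anti: "sqrt (g / v) \<le> sqrt (g / u)" if "0 < u" "u \<le> v" for u v
    using that assms by (intro real_sqrt_le_mono divide_left_mono) auto
  consider "y \<le> hs" | "hs < x" | "x \<le> hs" "hs < y" by linarith
  then show ?thesis
  proof cases
    case 3
    then have "shock_deriv g hs y \<le> sqrt (g / x)"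
      using order_trans[OF D_anti[of hs y] R_anti[of x hs, folded shock_deriv_at_hs[OF assms(2)]]] assms by linarith
    with 3 show ?thesis by (simp add: wave_deriv_def)
  qed (use assms D_anti[of x y] R_anti[of x y] in \<open>auto simp: wave_deriv_def \<close>)
qed

text \<open>Since \<open>(h + hs) / (h * hs) = 1 / hs + 1 / h\<close>, the radicand never falls
  below \<open>g / (2 * hs)\<close>. The resulting unbounded growth yields a point where the depth
  function is nonnegative.\<close>

lemma wave_fun_ge_linear:
  assumes "g > 0" "hs > 0" "hs < h"
  shows "(h - hs) * sqrt (g / (2 * hs)) \<le> wave_fun g hs h"
proof -
  have "g / (2 * hs) \<le> 1 / 2 * g * ((h + hs) / (h * hs))"
    using assms by (simp add: field_simps)
  then show ?thesis
    using assms by (auto simp: wave_fun_def intro!: mult_left_mono)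
qed

lemma depth_fun_has_derivative:
  assumes "g > 0" "hl > 0" "hr > 0" "h > 0"
  shows "(depth_fun g hl hr ul ur has_real_derivative wave_deriv g hl h + wave_deriv g hr h) (at h)"
  using DERIV_diff[OF DERIV_add[OF DERIV_add[OF wave_fun_has_derivative[OF assms(1,2,4)]
      wave_fun_has_derivative[OF assms(1,3,4)]] DERIV_const[of ur]] DERIV_const[of ul]]
  by (simp add: depth_fun_def[abs_def])

lemma depth_fun_strict_mono:
  assumes "g > 0" "hl > 0" "hr > 0" "0 < x" "x < y"
  shows "depth_fun g hl hr ul ur x < depth_fun g hl hr ul ur y"
proof (rule DERIV_pos_imp_increasing[OF \<open>x < y\<close>])
  fix z assume "x \<le> z"
  then show "\<exists>d. (depth_fun g hl hr ul ur has_real_derivative d) (at z) \<and> 0 < d"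
    using assms depth_fun_has_derivative[of g hl hr z] wave_deriv_pos[of g _ z]
    by (meson add_pos_pos less_le_trans)
qed

text \<open>Intermediate value theorem between a small depth \<open>a\<close>, where both waves are
  rarefactions, and a large depth \<open>b\<close>, where both are shocks; uniqueness is strict
  monotonicity.\<close>

lemma depth_fun_ex1_root:
  assumes "g > 0" "hl > 0" "hr > 0"
    and "ur - ul < 2 * sqrt (g * hl) + 2 * sqrt (g * hr)"
  shows "\<exists>!h. 0 < h \<and> depth_fun g hl hr ul ur h = 0"
proof -
  let ?\<phi> = "depth_fun g hl hr ul ur"
  \<comment> \<open>\<open>c\<close> is the margin in the no-dry-state condition. Below both depths
    the depth function equals \<open>4 * sqrt (g * a) - c\<close>, and the choice of
    \<open>a\<close> makes the first term at most \<open>c / 2\<close>.\<close>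
  define c where "c = 2 * sqrt (g * hl) + 2 * sqrt (g * hr) - (ur - ul)"
  define a where "a = min (min hl hr) ((c / 8)^2 / g)"
  have "c > 0" using assms by (simp add: c_def)
  then have "a > 0" using assms by (simp add: a_def)
  have "g * a \<le> (c / 8)^2" using assms by (simp add: a_def min_def field_simps)
  then have "sqrt (g * a) \<le> c / 8" using \<open>c > 0\<close> by (intro real_le_lsqrt) auto
  then have neg: "?\<phi> a \<le> 0"
  proof -
    have "a \<le> hl" "a \<le> hr" by (simp_all add: a_def)
    with \<open>sqrt (g * a) \<le> c / 8\<close> \<open>c > 0\<close> show ?thesis
      unfolding depth_fun_def wave_fun_def c_def by simp
  qed
  \<comment> \<open>\<open>k\<close> is the slope of the linear lower bound for the left wave.
    \<open>b\<close> is so far beyond \<open>hl\<close> that this wave alone outweighs the velocity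
    difference, while the right wave is nonnegative.\<close>
  define k where "k = sqrt (g / (2 * hl))"
  define b where "b = max hl hr + 1 + \<bar>ul - ur\<bar> / k"
  have "k > 0" using assms by (simp add: k_def)
  then have b: "b > hl" "b > hr" "b - hl \<ge> \<bar>ul - ur\<bar> / k"
    by (auto simp: b_def max_def add_pos_nonneg add.assoc) (smt (verit) divide_nonneg_pos)+
  have "\<bar>ul - ur\<bar> \<le> (b - hl) * k" using b(3) \<open>k > 0\<close> by (simp add: field_simps)
  also have "\<dots> \<le> wave_fun g hl b" unfolding k_def using assms b by (intro wave_fun_ge_linear)
  finally have "\<bar>ul - ur\<bar> \<le> wave_fun g hl b" .
  moreover have "0 \<le> wave_fun g hr b"
    using wave_fun_ge_linear[of g hr b] assms b
    by (smt (verit) divide_nonneg_pos mult_nonneg_nonneg real_sqrt_ge_zero)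
  ultimately have nonneg: "0 \<le> ?\<phi> b" by (simp add: depth_fun_def)
  have "a \<le> b" using b by (simp add: a_def)
  have "\<forall>x. a \<le> x \<and> x \<le> b \<longrightarrow> isCont ?\<phi> x"
    using depth_fun_has_derivative[of g hl hr] assms \<open>a > 0\<close> by (meson DERIV_isCont less_le_trans)
  then obtain h where "a \<le> h" "?\<phi> h = 0"
    using IVT[of ?\<phi> a 0 b] neg nonneg \<open>a \<le> b\<close> by blast
  then have "0 < h \<and> ?\<phi> h = 0" using \<open>a > 0\<close> by simp
  moreover have "x = y" if "0 < x \<and> ?\<phi> x = 0" "0 < y \<and> ?\<phi> y = 0" for x y
    using depth_fun_strict_mono[of g hl hr x y ul ur] depth_fun_strict_mono[of g hl hr y x ul ur] assms that
    by (cases x y rule: linorder_cases) auto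
  ultimately show ?thesis by blast
qed

theorem mainTheorem4:
  fixes g hl hr ul ur h0 :: real
  assumes "g > 0" and "hl > 0" and "hr > 0"
    and no_dry_state: "ur - ul < 2 * sqrt (g * hl) + 2 * sqrt (g * hr)"
    and "h0 > 0"
  defines "\<phi> \<equiv> depth_fun g hl hr ul ur"
    and "hstar \<equiv> intermediate_depth g hl hr ul ur"
    and "hmin \<equiv> min hl hr"
  defines "h0' \<equiv> max hmin (h0 - \<phi> h0 / deriv \<phi> h0)"
  shows "h0 - \<phi> h0 / deriv \<phi> h0 \<le> hstar \<and>
    (hmin \<le> hstar \<longrightarrow>
      h0' \<le> hstar \<and>
      (\<forall>k. newton_iter \<phi> h0' k > 0) \<and>
      (\<lambda>k. newton_iter \<phi> h0' k) \<longlonglongrightarrow> hstar)"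
proof -
  let ?D = "\<lambda>h. wave_deriv g hl h + wave_deriv g hr h"
  \<comment> \<open>Existence and uniqueness make the definite description in
    \<open>intermediate_depth\<close> denote the root.\<close>
  have root: "hstar > 0" "\<phi> hstar = 0"
    using theI'[OF depth_fun_ex1_root[OF assms(1-4)]]
    by (simp_all add: hstar_def \<phi>_def intermediate_depth_def)
  have der: "(\<phi> has_real_derivative ?D h) (at h)" if "h > 0" for h
    unfolding \<phi>_def using assms(1-3) that by (rule depth_fun_has_derivative)
  have anti: "?D y \<le> ?D x" if "0 < x" "x \<le> y" for x y
    using assms(1-3) that by (intro add_mono wave_deriv_antimono)
  have pos: "?D h > 0" if "h > 0" for h
    using assms(1-3) that by (intro add_pos_pos wave_deriv_pos)
  have step: "h0 - \<phi> h0 / deriv \<phi> h0 \<le> hstar"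
    using newton_step_le_root[OF der anti pos root \<open>h0 > 0\<close>] by (simp add: newton_step_def)
  \<comment> \<open>A single Newton step from \<open>h0\<close> may land at a nonpositive depth; the
    maximum with \<open>hmin\<close> guarantees a positive starting point.\<close>
  have "0 < h0'" using assms(2,3) by (simp add: h0'_def hmin_def less_max_iff_disj)
  moreover have "h0' \<le> hstar" if "hmin \<le> hstar" using that step by (simp add: h0'_def)
  ultimately show ?thesis
    using step newton_iter_increasing_concave[OF der anti pos root] by blast
qed

end
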